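(* Let $(X,d)$ and $(Y,d')$ be complete metric spaces, let $f=\phi_x:\mathbb{R}\to X$ be an almost periodic orbit of a flow $\phi:\mathbb{R}\times X\to X$, and let $g=\psi_y:\mathbb{R}\to Y$ be an almost periodic orbit of a flow $\psi:\mathbb{R}\times Y\to Y$. If $\mathfrak{M}_f=\mathfrak{M}_g$, then there is a topological group isomorphism $h:\overline{f(\mathbb{R})}\to\overline{g(\mathbb{R})}$, with respect to the group structures inherited from the orbits $f$ and $g$, such that $\mathrm{id}_{\mathbb{R}}\times h$ is an equivalence between $\phi|_{\mathbb{R}\times\overline{f(\mathbb{R})}}$ and $\psi|_{\mathbb{R}\times\overline{g(\mathbb{R})}}$; that is, $h(\phi(t,z))=\psi(t,h(z))$ for all $t\in\mathbb{R}$ and $z\in\overline{f(\mathbb{R})}$.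
   Context: A flow on $X$ is a continuous group action $\phi:\mathbb{R}\times X\to X$ of $(\mathbb{R},+)$; the orbit of $x$ is the map $\phi_x:t\mapsto\phi(t,x)$. A continuous map $f:\mathbb{R}\to X$ into a metric space $(X,d)$ is almost periodic if for every $\varepsilon>0$ the set of $\tau\in\mathbb{R}$ with $\sup_{t}d(f(t),f(t+\tau))\le\varepsilon$ is relatively dense, i.e. there is $L>0$ such that every interval $(r,r+L)$ meets it. Let $S^1=\mathbb{R}/\mathbb{Z}$ with quotient map $\pi:\mathbb{R}\to S^1$. For almost periodic $f$, $\mathfrak{M}_f$ denotes the countable subgroup of $(\mathbb{R},+)$, known to exist and to be uniquely determined by $f$, such that for every sequence $\{t_i\}$ of reals: $\{f(t_i)\}$ converges in $X$ if and only if $\{\pi(\lambda t_i)\}$ converges in $S^1$ for all $\lambda\in\mathfrak{M}_f$. For an almost periodic orbit $f$ of a flow on a complete metric space, the closure $\overline{f(\mathbb{R})}$ is a topological abelian group (Nemytskii) under $\lim f(t_i)+\lim f(t_i')=\lim f(t_i+t_i')$, with identity $f(0)$; this is the inherited group structure. *)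

theory Defs
  imports "HOL-Analysis.Analysis" "HOL-Algebra.Group"
begin

definition flow :: "(real \<Rightarrow> 'a::topological_space \<Rightarrow> 'a) \<Rightarrow> bool" where
  "flow \<phi> \<longleftrightarrow>
     continuous_on UNIV (\<lambda>p. \<phi> (fst p) (snd p)) \<and>
     (\<forall>x. \<phi> 0 x = x) \<and>
     (\<forall>s t x. \<phi> (s + t) x = \<phi> s (\<phi> t x))"

definition orbit_map :: "(real \<Rightarrow> 'a \<Rightarrow> 'a) \<Rightarrow> 'a \<Rightarrow> real \<Rightarrow> 'a" where
  "orbit_map \<phi> x = (\<lambda>t. \<phi> t x)"

definition relatively_dense :: "real set \<Rightarrow> bool" where
  "relatively_dense A \<longleftrightarrow> (\<exists>L>0. \<forall>r. {r<..<r + L} \<inter> A \<noteq> {})"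

text \<open>The condition that the supremum over t of the distances is at most \<epsilon> is spelled
  out pointwise, because \<open>Sup\<close> on the reals is unspecified on unbounded sets.\<close>

definition almost_periodic :: "(real \<Rightarrow> 'a::metric_space) \<Rightarrow> bool" where
  "almost_periodic f \<longleftrightarrow>
     continuous_on UNIV f \<and>
     (\<forall>\<epsilon>>0. relatively_dense {\<tau>. \<forall>t. dist (f t) (f (t + \<tau>)) \<le> \<epsilon>})"

text \<open>The circle as the quotient of the reals by the integers, with the quotient topology;
  \<open>circle_of\<close> is the quotient map.\<close>

quotient_type circle = real / "\<lambda>a b :: real. a - b \<in> \<int>"
  morphisms circle_rep circle_of
proof (rule equivpI)
  show "reflp (\<lambda>a b :: real. a - b \<in> \<int>)"
    by (simp add: reflp_def)
  show "symp (\<lambda>a b :: real. a - b \<in> \<int>)"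
    by (metis (no_types, lifting) Ints_minus minus_diff_eq sympI)
  show "transp (\<lambda>a b :: real. a - b \<in> \<int>)"
  proof (rule transpI)
    fix a b c :: real
    assume "a - b \<in> \<int>" "b - c \<in> \<int>"
    then have "(a - b) + (b - c) \<in> \<int>" by (rule Ints_add)
    then show "a - c \<in> \<int>" by simp
  qed
qed

instantiation circle :: topological_space
begin

definition open_circle :: "circle set \<Rightarrow> bool" where
  "open_circle U \<longleftrightarrow> open (circle_of -` U)"

instance
proof
  show "open (UNIV :: circle set)"
    by (simp add: open_circle_def)
  show "open (S \<inter> T)" if "open S" "open T" for S T :: "circle set"
    using that by (simp add: open_circle_def open_Int)
  show "open (\<Union>K)" if "\<forall>S\<in>K. open S" for K :: "circle set set"
    using that by (auto simp: open_circle_def vimage_Union)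
qed

end

abbreviation real_add_group :: "real monoid" where
  "real_add_group \<equiv> \<lparr>carrier = UNIV, monoid.mult = (+), one = 0\<rparr>"

text \<open>\<open>convergence_module f M\<close> says that \<open>M\<close> is the group \<open>\<MM>\<^sub>f\<close> attached
  to \<open>f\<close>. For an almost periodic orbit \<open>f\<close> of a flow on a complete metric space there is
  exactly one such \<open>M\<close>; it is presented as a relation so that no choice operator is needed.\<close>

definition convergence_module :: "(real \<Rightarrow> 'a::metric_space) \<Rightarrow> real set \<Rightarrow> bool" where
  "convergence_module f M \<longleftrightarrow>
     countable M \<and> subgroup M real_add_group \<and>
     (\<forall>t :: nat \<Rightarrow> real.
        convergent (\<lambda>i. f (t i)) \<longleftrightarrow> (\<forall>\<mu>\<in>M. convergent (\<lambda>i. circle_of (\<mu> * t i))))"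

text \<open>The sum of \<open>u\<close> and \<open>v\<close> is the common limit of \<open>f (s i + s' i)\<close> over all
  sequences with \<open>f (s i)\<close> tending to \<open>u\<close> and \<open>f (s' i)\<close> tending to \<open>v\<close>. It is well
  defined on the carrier when \<open>f\<close> is an almost periodic orbit of a flow on a complete space.\<close>

definition orbit_closure_group :: "(real \<Rightarrow> 'a::metric_space) \<Rightarrow> 'a monoid" where
  "orbit_closure_group f =
     \<lparr>carrier = closure (range f),
      monoid.mult = (\<lambda>u v. THE w. \<forall>s s' :: nat \<Rightarrow> real.
         (\<lambda>i. f (s i)) \<longlonglongrightarrow> u \<longrightarrow> (\<lambda>i. f (s' i)) \<longlonglongrightarrow> v \<longrightarrow>
         (\<lambda>i. f (s i + s' i)) \<longlonglongrightarrow> w),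
      one = f 0\<rparr>"

text \<open>Carriers carry the subspace topology of the ambient type.\<close>

definition topological_group_iso ::
  "('a::topological_space, 'c) monoid_scheme \<Rightarrow> ('b::topological_space, 'd) monoid_scheme
     \<Rightarrow> ('a \<Rightarrow> 'b) \<Rightarrow> bool" where
  "topological_group_iso G H h \<longleftrightarrow>
     h \<in> iso G H \<and> (\<exists>h'. homeomorphism (carrier G) (carrier H) h h')"

end

theory Submission
  imports Defs
begin

text \<open>Both orbits have the same convergence module, so \<open>f (t i)\<close> converges iff \<open>g (t i)\<close> does,
  and \<open>h (lim f (t i)) = lim g (t i)\<close> defines the map. Interleaving two sequences shows that
  limits of \<open>g\<close> depend only on limits of \<open>f\<close>; a diagonal choice of times gives continuity.
  Convergence on the circle is stable under addition, so \<open>f (s i + s' i)\<close> converges whenever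
  \<open>f (s i)\<close> and \<open>f (s' i)\<close> do; this makes the product well defined and \<open>h\<close> a homomorphism.\<close>

section \<open>Sums of convergent sequences on the circle\<close>

lemma open_circle_of_image:
  assumes "open U"
  shows "open (circle_of ` U)"
proof -
  \<comment> \<open>The saturation of \<open>U\<close> is the union of its integer translates, and
    each translate is open.\<close>
  have "circle_of -` circle_of ` U = (\<Union>k\<in>\<int>. (+) k ` U)"
  proof (intro equalityI subsetI)
    fix a assume "a \<in> circle_of -` circle_of ` U"
    then obtain b where "b \<in> U" "a - b \<in> \<int>"
      by (auto simp: circle.abs_eq_iff)
    then show "a \<in> (\<Union>k\<in>\<int>. (+) k ` U)"
      by (intro UN_I[of "a - b"] image_eqI[of _ _ b]) auto
  next
    fix a assume "a \<in> (\<Union>k\<in>\<int>. (+) k ` U)"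
    then obtain k b where "k \<in> \<int>" "b \<in> U" "a = k + b"
      by auto
    then have "circle_of a = circle_of b"
      by (simp add: circle.abs_eq_iff)
    with \<open>b \<in> U\<close> show "a \<in> circle_of -` circle_of ` U"
      by auto
  qed
  then show ?thesis
    using assms by (auto simp: open_circle_def intro!: open_translation)
qed

text \<open>Continuity of addition on the circle, phrased through real representatives so that no
  group operation on \<open>circle\<close> has to be introduced.\<close>

lemma tendsto_circle_of_add:
  assumes "((\<lambda>i. circle_of (a i)) \<longlongrightarrow> circle_of A) F" "((\<lambda>i. circle_of (b i)) \<longlongrightarrow> circle_of B) F"
  shows "((\<lambda>i. circle_of (a i + b i)) \<longlongrightarrow> circle_of (A + B)) F"
proof (rule topological_tendstoI)
  fix U assume U: "open U" "circle_of (A + B) \<in> U"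
  then obtain e where e: "e > 0" "ball (A + B) e \<subseteq> circle_of -` U"
    by (auto simp: open_circle_def elim: openE)
  have near: "\<forall>\<^sub>F i in F. circle_of (c i) \<in> circle_of ` ball C (e / 2)"
    if "((\<lambda>i. circle_of (c i)) \<longlongrightarrow> circle_of C) F" for c C
    using topological_tendstoD[OF that open_circle_of_image[OF open_ball]] \<open>e > 0\<close> by auto
  show "\<forall>\<^sub>F i in F. circle_of (a i + b i) \<in> U"
    using near[OF assms(1)] near[OF assms(2)]
  proof eventually_elim
    case (elim i)
    \<comment> \<open>Since the quotient map is open, the images of the half-radius balls are
      neighbourhoods of the limits. So \<open>a i\<close> and \<open>b i\<close> can be shifted by
      integers to land near \<open>A\<close> and \<open>B\<close>, and the two shifts add up to an
      integer.\<close>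
    then obtain a' b' where *: "dist A a' < e / 2" "a i - a' \<in> \<int>" "dist B b' < e / 2" "b i - b' \<in> \<int>"
      by (auto simp: circle.abs_eq_iff)
    then have "(a i - a') + (b i - b') \<in> \<int>"
      by (intro Ints_add)
    then have "circle_of (a i + b i) = circle_of (a' + b')"
      by (simp add: circle.abs_eq_iff algebra_simps)
    moreover have "a' + b' \<in> ball (A + B) e"
      using *(1,3) unfolding mem_ball dist_real_def by linarith
    ultimately show ?case
      using e(2) by auto
  qed
qed

lemma convergent_circle_of_add:
  assumes "convergent (\<lambda>i. circle_of (a i))" "convergent (\<lambda>i. circle_of (b i))"
  shows "convergent (\<lambda>i. circle_of (a i + b i))"
proof -
  obtain A B where "(\<lambda>i. circle_of (a i)) \<longlonglongrightarrow> A" "(\<lambda>i. circle_of (b i)) \<longlonglongrightarrow> B"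
    using assms by (auto simp: convergent_def)
  \<comment> \<open>Induction on the quotient type gives surjectivity of \<open>circle_of\<close>,
    so the limits have real representatives.\<close>
  moreover obtain A' B' where "A = circle_of A'" "B = circle_of B'"
    using that circle.abs_induct[of "\<lambda>c. c \<in> range circle_of"] by blast
  ultimately show ?thesis
    using tendsto_circle_of_add[of a A' sequentially b B'] by (auto simp: convergent_def)
qed

text \<open>For each frequency \<open>\<mu>\<close> in \<open>M\<close> the phase of
  \<open>s i + s' i\<close> splits into two phases that converge on the circle; the criterion is
  used once in each direction.\<close>

lemma convergence_module_convergent_add:
  assumes "convergence_module f M" "convergent (\<lambda>i. f (s i))" "convergent (\<lambda>i. f (s' i))"
  shows "convergent (\<lambda>i. f (s i + s' i))"
  using assms by (simp add: convergence_module_def distrib_left convergent_circle_of_add)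

section \<open>Transfer of limits from one function to another\<close>

definition interleave :: "(nat \<Rightarrow> 'a) \<Rightarrow> (nat \<Rightarrow> 'a) \<Rightarrow> nat \<Rightarrow> 'a" where
  "interleave s r i = (if even i then s (i div 2) else r (i div 2))"

lemma interleave_even_odd [simp]:
  "interleave s r (2 * n) = s n" "interleave s r (Suc (2 * n)) = r n"
  by (simp_all add: interleave_def)

lemma tendsto_interleave:
  fixes F :: "'s \<Rightarrow> 'a::topological_space"
  assumes "(\<lambda>i. F (s i)) \<longlonglongrightarrow> z" "(\<lambda>i. F (r i)) \<longlonglongrightarrow> z"
  shows "(\<lambda>i. F (interleave s r i)) \<longlonglongrightarrow> z"
proof (rule topological_tendstoI)
  fix U assume "open U" "z \<in> U"
  then obtain M N where MN: "\<And>n. n \<ge> M \<Longrightarrow> F (s n) \<in> U" "\<And>n. n \<ge> N \<Longrightarrow> F (r n) \<in> U"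
    using assms by (metis topological_tendstoD eventually_sequentially)
  have "F (interleave s r n) \<in> U" if "n \<ge> 2 * max M N" for n
  proof -
    have "n div 2 \<ge> M" "n div 2 \<ge> N"
      using that by linarith+
    then show ?thesis
      using MN by (simp add: interleave_def)
  qed
  then show "\<forall>\<^sub>F n in sequentially. F (interleave s r n) \<in> U"
    using eventually_sequentially by blast
qed

text \<open>The hypothesis \<open>transfer\<close> speaks of convergence only, not of limits.
  Interleaving closes the gap: \<open>G\<close> converges along the mixed sequence, so its even and
  odd subsequences share one limit.\<close>

lemma tendsto_if_convergent_transfer:
  fixes F :: "'s \<Rightarrow> 'a::topological_space" and G :: "'s \<Rightarrow> 'b::t2_space"
  assumes transfer: "\<And>t :: nat \<Rightarrow> 's. convergent (\<lambda>i. F (t i)) \<Longrightarrow> convergent (\<lambda>i. G (t i))"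
    and "(\<lambda>i. F (s i)) \<longlonglongrightarrow> z" "(\<lambda>i. F (r i)) \<longlonglongrightarrow> z" "(\<lambda>i. G (s i)) \<longlonglongrightarrow> w"
  shows "(\<lambda>i. G (r i)) \<longlonglongrightarrow> w"
proof -
  let ?t = "interleave s r"
  have "(\<lambda>i. F (?t i)) \<longlonglongrightarrow> z"
    using assms(2,3) by (rule tendsto_interleave)
  then obtain w' where w': "(\<lambda>i. G (?t i)) \<longlonglongrightarrow> w'"
    using transfer by (auto simp: convergent_def)
  have "(\<lambda>i. G (?t (2 * i))) \<longlonglongrightarrow> w'" "(\<lambda>i. G (?t (Suc (2 * i)))) \<longlonglongrightarrow> w'"
    using LIMSEQ_subseq_LIMSEQ[OF w', of "\<lambda>i. 2 * i"] LIMSEQ_subseq_LIMSEQ[OF w', of "\<lambda>i. Suc (2 * i)"]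
    by (simp_all add: strict_mono_def o_def)
  with assms(4) show ?thesis
    using LIMSEQ_unique by auto
qed

text \<open>Legitimizes definite descriptions of limits. The given sequence \<open>s\<close>
  supplies the value and also forces uniqueness; with no sequence approaching \<open>z\<close> the
  condition would be vacuous.\<close>

lemma ex1_limit_if_convergent_transfer:
  fixes F :: "'s \<Rightarrow> 'a::topological_space" and G :: "'s \<Rightarrow> 'b::t2_space"
  assumes transfer: "\<And>t :: nat \<Rightarrow> 's. convergent (\<lambda>i. F (t i)) \<Longrightarrow> convergent (\<lambda>i. G (t i))"
    and s: "(\<lambda>i. F (s i)) \<longlonglongrightarrow> z"
  shows "\<exists>!w. \<forall>t :: nat \<Rightarrow> 's. (\<lambda>i. F (t i)) \<longlonglongrightarrow> z \<longrightarrow> (\<lambda>i. G (t i)) \<longlonglongrightarrow> w"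
proof -
  obtain w where w: "(\<lambda>i. G (s i)) \<longlonglongrightarrow> w"
    using transfer s by (auto simp: convergent_def)
  show ?thesis
  proof (intro ex1I allI impI)
    show "(\<lambda>i. G (t i)) \<longlonglongrightarrow> w" if "(\<lambda>i. F (t i)) \<longlonglongrightarrow> z" for t
      using tendsto_if_convergent_transfer[OF transfer s that w] .
    show "w' = w" if "\<forall>t :: nat \<Rightarrow> 's. (\<lambda>i. F (t i)) \<longlonglongrightarrow> z \<longrightarrow> (\<lambda>i. G (t i)) \<longlonglongrightarrow> w'" for w'
      using that s w LIMSEQ_unique by blast
  qed
qed

lemma closure_range_sequence:
  fixes f :: "'s \<Rightarrow> 'a::metric_space"
  assumes "z \<in> closure (range f)"
  obtains s where "(\<lambda>i::nat. f (s i)) \<longlonglongrightarrow> z"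
proof -
  from assms obtain p where p: "\<forall>n. \<exists>t. p n = f t" "p \<longlonglongrightarrow> z"
    unfolding closure_sequential image_iff by auto
  obtain s where "p = (\<lambda>n. f (s n))"
    using choice[OF p(1)] by auto
  with p(2) show thesis
    using that by simp
qed

lemma limit_in_closure_range:
  fixes f :: "'s \<Rightarrow> 'a::metric_space"
  assumes "(\<lambda>i::nat. f (s i)) \<longlonglongrightarrow> z"
  shows "z \<in> closure (range f)"
  unfolding closure_sequential using assms by (intro exI[of _ "\<lambda>i. f (s i)"] conjI) auto

text \<open>With \<open>f\<close> and \<open>g\<close> for \<open>F\<close> and \<open>G\<close>
  this is the isomorphism sought. The value is meaningful when some \<open>F (t i)\<close> tends to
  \<open>z\<close> and convergence passes from \<open>F\<close> to \<open>G\<close>.\<close>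

definition limit_transfer :: "('s \<Rightarrow> 'a::topological_space) \<Rightarrow> ('s \<Rightarrow> 'b::topological_space) \<Rightarrow> 'a \<Rightarrow> 'b" where
  "limit_transfer F G z =
     (THE w. \<forall>t :: nat \<Rightarrow> 's. (\<lambda>i. F (t i)) \<longlonglongrightarrow> z \<longrightarrow> (\<lambda>i. G (t i)) \<longlonglongrightarrow> w)"

lemma tendsto_limit_transfer:
  fixes F :: "'s \<Rightarrow> 'a::topological_space" and G :: "'s \<Rightarrow> 'b::t2_space"
  assumes "\<And>t :: nat \<Rightarrow> 's. convergent (\<lambda>i. F (t i)) \<Longrightarrow> convergent (\<lambda>i. G (t i))"
    and "(\<lambda>i. F (s i)) \<longlonglongrightarrow> z"
  shows "(\<lambda>i. G (s i)) \<longlonglongrightarrow> limit_transfer F G z"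
  using theI'[OF ex1_limit_if_convergent_transfer[of F G, OF assms]] assms(2)
  by (simp add: limit_transfer_def)

lemma tendsto_dist_transform:
  fixes u v :: "'i \<Rightarrow> 'a::metric_space"
  assumes "(u \<longlongrightarrow> a) F" "((\<lambda>n. dist (u n) (v n)) \<longlongrightarrow> 0) F"
  shows "(v \<longlongrightarrow> a) F"
proof -
  have sum: "((\<lambda>n. dist (u n) (v n) + dist (u n) a) \<longlongrightarrow> 0) F"
    using tendsto_add[OF assms(2) assms(1)[THEN tendsto_dist_iff[THEN iffD1]]] by simp
  have le: "\<forall>n. norm (dist (v n) a) \<le> dist (u n) (v n) + dist (u n) a"
    by (simp add: dist_triangle3)
  have "((\<lambda>n. dist (v n) a) \<longlongrightarrow> 0) F"
    by (rule Lim_null_comparison[OF always_eventually[OF le] sum])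
  then show ?thesis
    by (simp add: tendsto_dist_iff[of v])
qed

lemma continuous_on_limit_transfer:
  fixes F :: "'s \<Rightarrow> 'a::metric_space" and G :: "'s \<Rightarrow> 'b::metric_space"
  assumes transfer: "\<And>t :: nat \<Rightarrow> 's. convergent (\<lambda>i. F (t i)) \<Longrightarrow> convergent (\<lambda>i. G (t i))"
  shows "continuous_on (closure (range F)) (limit_transfer F G)"
  unfolding continuous_on_sequentially o_def
proof (intro allI ballI impI)
  let ?h = "limit_transfer F G"
  fix z :: "nat \<Rightarrow> 'a" and a
  assume "a \<in> closure (range F)" and z: "(\<forall>n. z n \<in> closure (range F)) \<and> z \<longlonglongrightarrow> a"
  have lim: "(\<lambda>i. G (s i)) \<longlonglongrightarrow> ?h w" if "(\<lambda>i. F (s i)) \<longlonglongrightarrow> w" for s w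
    using transfer that by (rule tendsto_limit_transfer)
  \<comment> \<open>The points \<open>z n\<close> need not be values of \<open>F\<close>. Along a
    sequence approaching \<open>z n\<close> both distances are eventually small, so a single index
    \<open>q\<close> serves both; the bound \<open>1 / Suc n\<close> is positive already at
    \<open>n = 0\<close>.\<close>
  have "\<exists>q. dist (F q) (z n) < 1 / Suc n \<and> dist (G q) (?h (z n)) < 1 / Suc n" for n
  proof -
    obtain s where s: "(\<lambda>i::nat. F (s i)) \<longlonglongrightarrow> z n"
      using z closure_range_sequence by blast
    have "\<forall>\<^sub>F i in sequentially. dist (F (s i)) (z n) < 1 / Suc n \<and> dist (G (s i)) (?h (z n)) < 1 / Suc n"
      using tendstoD[OF s, of "1 / Suc n"] tendstoD[OF lim[OF s], of "1 / Suc n"]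
      by (simp add: eventually_conj_iff)
    then show ?thesis
      using eventually_happens' sequentially_bot by blast
  qed
  then obtain q where q: "\<And>n. dist (F (q n)) (z n) < 1 / Suc n" "\<And>n. dist (G (q n)) (?h (z n)) < 1 / Suc n"
    by metis
  have null: "c \<longlonglongrightarrow> 0" if "\<And>n. 0 \<le> c n" "\<And>n. c n < 1 / Suc n" for c :: "nat \<Rightarrow> real"
  proof (rule tendsto_sandwich)
    show "\<forall>\<^sub>F n in sequentially. 0 \<le> c n" "\<forall>\<^sub>F n in sequentially. c n \<le> 1 / real (Suc n)"
      using that by (simp_all add: always_eventually less_imp_le del: of_nat_Suc)
    show "(\<lambda>n. 1 / real (Suc n)) \<longlonglongrightarrow> 0"
      by (rule LIMSEQ_Suc[OF lim_1_over_n])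
  qed simp
  \<comment> \<open>The diagonal values \<open>F (q n)\<close> stay close to \<open>z n\<close>,
    hence tend to \<open>a\<close>. Transferring this one sequence and then replacing
    \<open>G (q n)\<close> by \<open>?h (z n)\<close> gives continuity.\<close>
  have "(\<lambda>n. F (q n)) \<longlonglongrightarrow> a"
    by (rule tendsto_dist_transform[of z]) (use z q(1) in \<open>auto intro!: null simp: dist_commute\<close>)
  then have "(\<lambda>n. G (q n)) \<longlonglongrightarrow> ?h a"
    by (rule lim)
  then show "(\<lambda>n. ?h (z n)) \<longlonglongrightarrow> ?h a"
    by (rule tendsto_dist_transform) (use q(2) in \<open>auto intro!: null\<close>)
qed

lemma homeomorphism_limit_transfer:
  fixes F :: "'s \<Rightarrow> 'a::metric_space" and G :: "'s \<Rightarrow> 'b::metric_space"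
  assumes "\<And>t :: nat \<Rightarrow> 's. convergent (\<lambda>i. F (t i)) \<longleftrightarrow> convergent (\<lambda>i. G (t i))"
  shows "homeomorphism (closure (range F)) (closure (range G)) (limit_transfer F G) (limit_transfer G F)"
proof -
  \<comment> \<open>Stated for fresh functions and types so that it applies in both directions. One
    sequence of indices realizes \<open>z\<close> under \<open>F\<close> and its image under
    \<open>G\<close>, and so leads back to \<open>z\<close>.\<close>
  have inv: "limit_transfer F G z \<in> closure (range G) \<and> limit_transfer G F (limit_transfer F G z) = z"
    if z: "z \<in> closure (range F)" and conv: "\<And>t :: nat \<Rightarrow> 's. convergent (\<lambda>i. F (t i)) \<longleftrightarrow> convergent (\<lambda>i. G (t i))"
    for F :: "'s \<Rightarrow> 'c::metric_space" and G :: "'s \<Rightarrow> 'd::metric_space" and z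
  proof -
    obtain s where s: "(\<lambda>i::nat. F (s i)) \<longlonglongrightarrow> z"
      using z closure_range_sequence by blast
    have Gs: "(\<lambda>i. G (s i)) \<longlonglongrightarrow> limit_transfer F G z"
      using conv s by (intro tendsto_limit_transfer) auto
    then have "(\<lambda>i. F (s i)) \<longlonglongrightarrow> limit_transfer G F (limit_transfer F G z)"
      by (rule tendsto_limit_transfer[rotated]) (use conv in auto)
    with s Gs show ?thesis
      using LIMSEQ_unique limit_in_closure_range by blast
  qed
  show ?thesis
  proof (rule homeomorphismI)
    show "continuous_on (closure (range F)) (limit_transfer F G)"
      "continuous_on (closure (range G)) (limit_transfer G F)"
      by (rule continuous_on_limit_transfer; simp add: assms)+
  qed (use inv[of _ F G] inv[of _ G F] assms in auto)
qed

section \<open>The group law and the flow on an orbit closure\<close>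

lemma tendsto_orbit_closure_mult:
  fixes f :: "real \<Rightarrow> 'a::metric_space"
  assumes "convergence_module f M" and s: "(\<lambda>i::nat. f (s i)) \<longlonglongrightarrow> u" "(\<lambda>i. f (s' i)) \<longlonglongrightarrow> v"
  shows "(\<lambda>i. f (s i + s' i)) \<longlonglongrightarrow> u \<otimes>\<^bsub>orbit_closure_group f\<^esub> v"
proof -
  \<comment> \<open>The product is itself a limit transfer, indexed by pairs of times: from the pair
    of orbit points to the orbit point at the summed time.\<close>
  let ?F = "\<lambda>p. (f (fst p), f (snd p))" and ?G = "\<lambda>p. f (fst p + snd p)"
  have "\<exists>!w. \<forall>t :: nat \<Rightarrow> real \<times> real. (\<lambda>i. ?F (t i)) \<longlonglongrightarrow> (u, v) \<longrightarrow> (\<lambda>i. ?G (t i)) \<longlonglongrightarrow> w"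
  proof (rule ex1_limit_if_convergent_transfer)
    show "(\<lambda>i. ?F (s i, s' i)) \<longlonglongrightarrow> (u, v)"
      using s by (auto intro: tendsto_Pair)
    fix t :: "nat \<Rightarrow> real \<times> real" assume "convergent (\<lambda>i. ?F (t i))"
    then obtain c where c: "(\<lambda>i. ?F (t i)) \<longlonglongrightarrow> c"
      by (auto simp: convergent_def)
    have "convergent (\<lambda>i. f (fst (t i)))" "convergent (\<lambda>i. f (snd (t i)))"
      using tendsto_fst[OF c] tendsto_snd[OF c] by (auto simp: convergent_def)
    then show "convergent (\<lambda>i. ?G (t i))"
      using convergence_module_convergent_add[OF assms(1)] by simp
  qed
  \<comment> \<open>Currying: a sequence of pairs amounts to two sequences, which matches the
    description inside \<open>orbit_closure_group\<close>.\<close>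
  moreover have "(\<forall>t :: nat \<Rightarrow> real \<times> real. (\<lambda>i. ?F (t i)) \<longlonglongrightarrow> (u, v) \<longrightarrow> (\<lambda>i. ?G (t i)) \<longlonglongrightarrow> w) \<longleftrightarrow>
      (\<forall>s s' :: nat \<Rightarrow> real. (\<lambda>i. f (s i)) \<longlonglongrightarrow> u \<longrightarrow> (\<lambda>i. f (s' i)) \<longlonglongrightarrow> v \<longrightarrow>
         (\<lambda>i. f (s i + s' i)) \<longlonglongrightarrow> w)" (is "?L \<longleftrightarrow> ?R") for w
  proof
    assume L: ?L
    show ?R
    proof (intro allI impI)
      fix s s' :: "nat \<Rightarrow> real" assume "(\<lambda>i. f (s i)) \<longlonglongrightarrow> u" "(\<lambda>i. f (s' i)) \<longlonglongrightarrow> v"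
      then show "(\<lambda>i. f (s i + s' i)) \<longlonglongrightarrow> w"
        using L[rule_format, of "\<lambda>i. (s i, s' i)"] by (simp add: tendsto_Pair)
    qed
  next
    assume R: ?R
    show ?L
    proof (intro allI impI)
      fix t :: "nat \<Rightarrow> real \<times> real" assume t: "(\<lambda>i. ?F (t i)) \<longlonglongrightarrow> (u, v)"
      show "(\<lambda>i. ?G (t i)) \<longlonglongrightarrow> w"
        using R tendsto_fst[OF t] tendsto_snd[OF t] by simp
    qed
  qed
  ultimately have "\<exists>!w. \<forall>s s' :: nat \<Rightarrow> real. (\<lambda>i. f (s i)) \<longlonglongrightarrow> u \<longrightarrow> (\<lambda>i. f (s' i)) \<longlonglongrightarrow> v \<longrightarrow>
         (\<lambda>i. f (s i + s' i)) \<longlonglongrightarrow> w"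
    by simp
  from theI'[OF this] s show ?thesis
    by (simp add: orbit_closure_group_def)
qed

text \<open>The time-\<open>t\<close> map is continuous and, by the action law, shifts orbit times
  by \<open>t\<close>; so the flow on the closure is again given by limits along times.\<close>

lemma flow_orbit_tendsto:
  assumes "flow \<phi>" "(\<lambda>i. orbit_map \<phi> x (s i)) \<longlonglongrightarrow> z"
  shows "(\<lambda>i. orbit_map \<phi> x (t + s i)) \<longlonglongrightarrow> \<phi> t z"
proof -
  have "continuous_on UNIV (\<lambda>p. \<phi> (fst p) (snd p))"
    using assms(1) by (simp add: flow_def)
  then have "continuous_on UNIV (\<lambda>z. \<phi> t z)"
    using continuous_on_compose2[of UNIV "\<lambda>p. \<phi> (fst p) (snd p)" UNIV "\<lambda>z. (t, z)"]
    by (simp add: continuous_on_Pair)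
  then have "(\<lambda>i. \<phi> t (orbit_map \<phi> x (s i))) \<longlonglongrightarrow> \<phi> t z"
    by (rule continuous_on_tendsto_compose[OF _ assms(2)]) simp_all
  then show ?thesis
    using assms(1) by (simp add: flow_def orbit_map_def)
qed

section \<open>The isomorphism and its equivariance\<close>

theorem theorem4:
  fixes \<phi> :: "real \<Rightarrow> 'a::complete_space \<Rightarrow> 'a"
    and \<psi> :: "real \<Rightarrow> 'b::complete_space \<Rightarrow> 'b"
    and x :: 'a and y :: 'b
    and f :: "real \<Rightarrow> 'a" and g :: "real \<Rightarrow> 'b"
    and Mf Mg :: "real set"
  assumes "flow \<phi>" and "f = orbit_map \<phi> x" and "almost_periodic f"
    and "flow \<psi>" and "g = orbit_map \<psi> y" and "almost_periodic g"
    and "convergence_module f Mf" and "convergence_module g Mg"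
    and "Mf = Mg"
  shows "\<exists>h. topological_group_iso (orbit_closure_group f) (orbit_closure_group g) h \<and>
             (\<forall>t. \<forall>z\<in>closure (range f). h (\<phi> t z) = \<psi> t (h z))"
proof -
  let ?h = "limit_transfer f g" and ?G = "orbit_closure_group f" and ?H = "orbit_closure_group g"
  \<comment> \<open>Both sides are equivalent to the same convergence condition on the
    circle.\<close>
  have conv: "convergent (\<lambda>i. f (t i)) \<longleftrightarrow> convergent (\<lambda>i. g (t i))" for t :: "nat \<Rightarrow> real"
    using assms(7-9) by (simp add: convergence_module_def)
  have h: "(\<lambda>i. g (s i)) \<longlonglongrightarrow> ?h z" if "(\<lambda>i. f (s i)) \<longlonglongrightarrow> z" for s z
    using conv that by (intro tendsto_limit_transfer) auto
  have carrier: "carrier ?G = closure (range f)" "carrier ?H = closure (range g)"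
    by (simp_all add: orbit_closure_group_def)
  have homeo: "homeomorphism (carrier ?G) (carrier ?H) ?h (limit_transfer g f)"
    unfolding carrier using conv by (rule homeomorphism_limit_transfer)
  have "?h \<in> iso ?G ?H"
  proof (rule isoI)
    show "bij_betw ?h (carrier ?G) (carrier ?H)"
      using homeo by (auto simp: homeomorphism_def intro!: bij_betw_byWitness[of _ "limit_transfer g f"])
    show "?h \<in> hom ?G ?H"
    proof (rule homI)
      show "?h u \<in> carrier ?H" if "u \<in> carrier ?G" for u
        using homeo that by (auto simp: homeomorphism_def)
      fix u v assume "u \<in> carrier ?G" "v \<in> carrier ?G"
      then obtain s s' where s: "(\<lambda>i::nat. f (s i)) \<longlonglongrightarrow> u" "(\<lambda>i::nat. f (s' i)) \<longlonglongrightarrow> v"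
        unfolding carrier by (elim closure_range_sequence)
      \<comment> \<open>The sequence at summed times has its limit computed twice: by multiplying in
        \<open>?G\<close> before the transfer, and by multiplying in \<open>?H\<close> after
        it.\<close>
      have "(\<lambda>i. g (s i + s' i)) \<longlonglongrightarrow> ?h (u \<otimes>\<^bsub>?G\<^esub> v)"
        by (intro h tendsto_orbit_closure_mult[OF assms(7)] s)
      moreover have "(\<lambda>i. g (s i + s' i)) \<longlonglongrightarrow> ?h u \<otimes>\<^bsub>?H\<^esub> ?h v"
        by (intro h tendsto_orbit_closure_mult[OF assms(8)] s)
      ultimately show "?h (u \<otimes>\<^bsub>?G\<^esub> v) = ?h u \<otimes>\<^bsub>?H\<^esub> ?h v"
        by (rule LIMSEQ_unique)
    qed
  qed
  moreover have "?h (\<phi> t z) = \<psi> t (?h z)" if z: "z \<in> closure (range f)" for t z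
  proof -
    obtain s where s: "(\<lambda>i::nat. f (s i)) \<longlonglongrightarrow> z"
      using z closure_range_sequence by blast
    \<comment> \<open>The same comparison of limits, now with all times shifted by the fixed
      \<open>t\<close>: flow before the transfer, or after it.\<close>
    have "(\<lambda>i. g (t + s i)) \<longlonglongrightarrow> ?h (\<phi> t z)"
      using flow_orbit_tendsto[OF assms(1)] s assms(2) by (intro h) simp
    moreover have "(\<lambda>i. g (t + s i)) \<longlonglongrightarrow> \<psi> t (?h z)"
      using flow_orbit_tendsto[OF assms(4)] h[OF s] assms(5) by simp
    ultimately show ?thesis
      by (rule LIMSEQ_unique)
  qed
  ultimately show ?thesis
    using homeo by (auto simp: topological_group_iso_def)
qed

end
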